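(* Let $d\ge 1$ be an integer and let $\rho$ be a quantum state of dimension $d$, i.e. a complex Hermitian positive semidefinite $d\times d$ matrix with $\operatorname{Tr}\rho=1$. Then the quantities $S_{\mathrm R}=S_{\mathrm R}(\rho)$ and $S_{\mathrm I}=S_{\mathrm I}(\rho)$ satisfy $$S_{\mathrm I}^2\ \le\ 1+S_{\mathrm R}^2 .$$
   Context: Write $\rho=\frac1d(R+I)$, where $R=\frac d2(\rho+\rho^T)$ is the (real symmetric) real part and $I=\frac d2(\rho-\rho^T)$ is the purely imaginary, skew-symmetric (Hermitian) part; here $^T$ denotes the transpose and $I$ is not the identity matrix. Write further $R=\mathbb 1_d+D+X$, where $\mathbb 1_d$ is the identity matrix, $D$ is the real traceless diagonal matrix whose diagonal entries are those of $R-\mathbb 1_d$, and $X$ is the real symmetric off-diagonal part of $R$ (zero diagonal). Define the nonnegative numbers $$S_{\mathrm D}=\sqrt{\operatorname{Tr}(D^2)/d},\quad S_{\mathrm X}=\sqrt{\operatorname{Tr}(X^2)/d},\quad S_{\mathrm I}=\sqrt{\operatorname{Tr}(I^2)/d},\quad S_{\mathrm R}=\sqrt{S_{\mathrm D}^2+S_{\mathrm X}^2},$$ so that $S_{\mathrm R}^2=\operatorname{Tr}(R^2)/d-1$. *)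

theory Defs
  imports "HOL-Analysis.Analysis"
begin

(* A d-dimensional complex matrix is an element of complex^'d^'d with d = CARD('d) >= 1. *)

definition adjoint_mat :: "complex^'d^'d \<Rightarrow> complex^'d^'d" where
  "adjoint_mat A = (\<chi> i j. cnj (transpose A $ i $ j))"

definition hermitian_mat :: "complex^'d^'d \<Rightarrow> bool" where
  "hermitian_mat A \<longleftrightarrow> adjoint_mat A = A"

definition pos_semidef :: "complex^'d^'d \<Rightarrow> bool" where
  "pos_semidef A \<longleftrightarrow>
     (\<forall>x :: complex^'d. (\<Sum>i\<in>UNIV. cnj (x $ i) * (A *v x) $ i) \<in> \<real>\<^sub>\<ge>\<^sub>0)"

definition quantum_state :: "complex^'d^'d \<Rightarrow> bool" where
  "quantum_state \<rho> \<longleftrightarrow> hermitian_mat \<rho> \<and> pos_semidef \<rho> \<and> trace \<rho> = 1"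

(* The parts are normalised so that \<rho> = (1/d) (R + I) and R = 1 + D + X;
   I is the skew-symmetric part, not the identity matrix. *)

definition R_mat :: "complex^'d^'d \<Rightarrow> complex^'d^'d" where
  "R_mat \<rho> = (real CARD('d) / 2) *\<^sub>R (\<rho> + transpose \<rho>)"

definition I_mat :: "complex^'d^'d \<Rightarrow> complex^'d^'d" where
  "I_mat \<rho> = (real CARD('d) / 2) *\<^sub>R (\<rho> - transpose \<rho>)"

definition D_mat :: "complex^'d^'d \<Rightarrow> complex^'d^'d" where
  "D_mat \<rho> = (\<chi> i j. if i = j then (R_mat \<rho> - mat 1) $ i $ j else 0)"

definition X_mat :: "complex^'d^'d \<Rightarrow> complex^'d^'d" where
  "X_mat \<rho> = (\<chi> i j. if i = j then 0 else R_mat \<rho> $ i $ j)"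

(* Taking Re loses nothing on Hermitian matrices, where the trace of the square is the
   sum of the squared moduli of the entries; see trace_square_hermitian below. *)

definition normalized_size :: "complex^'d^'d \<Rightarrow> real" where
  "normalized_size A = sqrt (Re (trace (A ** A)) / real CARD('d))"

definition S_D :: "complex^'d^'d \<Rightarrow> real" where
  "S_D \<rho> = normalized_size (D_mat \<rho>)"

definition S_X :: "complex^'d^'d \<Rightarrow> real" where
  "S_X \<rho> = normalized_size (X_mat \<rho>)"

definition S_I :: "complex^'d^'d \<Rightarrow> real" where
  "S_I \<rho> = normalized_size (I_mat \<rho>)"

definition S_R :: "complex^'d^'d \<Rightarrow> real" where
  "S_R \<rho> = sqrt ((S_D \<rho>)\<^sup>2 + (S_X \<rho>)\<^sup>2)"

lemma hermitian_mat_iff: "hermitian_mat A \<longleftrightarrow> (\<forall>i j. cnj (A $ j $ i) = A $ i $ j)"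
  by (simp add: hermitian_mat_def adjoint_mat_def transpose_def vec_eq_iff)

lemma hermitian_parts:
  assumes "hermitian_mat \<rho>"
  shows "hermitian_mat (R_mat \<rho>)" "hermitian_mat (I_mat \<rho>)"
    "hermitian_mat (D_mat \<rho>)" "hermitian_mat (X_mat \<rho>)"
  using assms
  by (auto simp: hermitian_mat_iff R_mat_def I_mat_def D_mat_def X_mat_def transpose_def mat_def)

lemma trace_square_hermitian:
  assumes "hermitian_mat A"
  shows "trace (A ** A) = of_real (\<Sum>i\<in>UNIV. \<Sum>j\<in>UNIV. (cmod (A $ i $ j))\<^sup>2)"
proof -
  have "A $ i $ j * A $ j $ i = of_real ((cmod (A $ i $ j))\<^sup>2)" for i j
    using assms by (metis hermitian_mat_iff complex_norm_square)
  then show ?thesis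
    by (simp add: trace_def matrix_matrix_mult_def)
qed

lemma state_decomposition:
  "\<rho> = (1 / real CARD('d)) *\<^sub>R (R_mat \<rho> + I_mat \<rho>)" for \<rho> :: "complex^'d^'d"
proof -
  have "R_mat \<rho> + I_mat \<rho> = real CARD('d) *\<^sub>R \<rho>"
    by (simp add: vec_eq_iff R_mat_def I_mat_def transpose_def field_simps scaleR_conv_of_real[where 'a = complex])
  then show ?thesis by simp
qed

lemma R_mat_decomposition: "R_mat \<rho> = mat 1 + D_mat \<rho> + X_mat \<rho>"
  by (auto simp: vec_eq_iff D_mat_def X_mat_def mat_def)

lemma trace_D_mat:
  fixes \<rho> :: "complex^'d^'d"
  assumes "trace \<rho> = 1"
  shows "trace (D_mat \<rho>) = 0"
proof -
  have "trace (D_mat \<rho>) = (\<Sum>i\<in>UNIV. of_nat CARD('d) * \<rho> $ i $ i - 1)"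
    unfolding trace_def
    by (intro sum.cong refl)
      (simp add: D_mat_def R_mat_def transpose_def mat_def scaleR_conv_of_real[where 'a = complex] field_simps)
  also have "\<dots> = of_nat CARD('d) * trace \<rho> - of_nat CARD('d)"
    by (simp add: trace_def sum_subtractf sum_distrib_left)
  finally show ?thesis using assms by simp
qed

lemma S_R_square:
  fixes \<rho> :: "complex^'d^'d"
  assumes "quantum_state \<rho>"
  shows "(S_R \<rho>)\<^sup>2 = Re (trace (R_mat \<rho> ** R_mat \<rho>)) / real CARD('d) - 1"
proof -
  let ?R = "R_mat \<rho>" and ?D = "D_mat \<rho>" and ?X = "X_mat \<rho>"
  have herm: "hermitian_mat \<rho>" and tr: "trace \<rho> = 1"
    using assms by (auto simp: quantum_state_def)
  have nonneg: "0 \<le> Re (trace (A ** A))" if "hermitian_mat A" for A :: "complex^'d^'d"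
    by (simp add: trace_square_hermitian[OF that] sum_nonneg)
  have entry: "?R $ i $ j * ?R $ j $ i = ?D $ i $ j * ?D $ j $ i + ?X $ i $ j * ?X $ j $ i
      + (if j = i then 1 + 2 * ?D $ i $ i else 0)" for i j
    by (auto simp: D_mat_def X_mat_def mat_def algebra_simps)
  have "trace (?R ** ?R) = trace (?D ** ?D) + trace (?X ** ?X) + (\<Sum>i\<in>UNIV. 1 + 2 * ?D $ i $ i)"
    by (simp add: trace_def matrix_matrix_mult_def entry sum.distrib)
  also have "(\<Sum>i\<in>UNIV. 1 + 2 * ?D $ i $ i) = of_nat CARD('d)"
    using trace_D_mat[OF tr] by (simp add: trace_def sum.distrib flip: sum_distrib_left)
  finally have "Re (trace (?R ** ?R)) =
      Re (trace (?D ** ?D)) + Re (trace (?X ** ?X)) + real CARD('d)"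
    by simp
  moreover have "(S_R \<rho>)\<^sup>2 = Re (trace (?D ** ?D)) / real CARD('d) + Re (trace (?X ** ?X)) / real CARD('d)"
    using nonneg[OF hermitian_parts(3)[OF herm]] nonneg[OF hermitian_parts(4)[OF herm]]
    by (simp add: S_R_def S_D_def S_X_def normalized_size_def)
  ultimately show ?thesis by (simp add: field_simps)
qed

end

theory Submission
  imports Defs
begin

text \<open>Since Tr(R R) - Tr(I I) is d squared times the trace of \<rho> times its transpose, the claim is that two positive semidefinite
  matrices have a nonnegative trace product. This is obtained without the spectral theorem: subtracting
  the rank-one matrix formed from the k-th column of A leaves a positive semidefinite matrix (the Schur
  complement) with fewer nonzero diagonal entries, and the trace product of a rank-one projector
  with B is a value of the quadratic form of B.\<close>

definition quad_form :: "complex^'n^'n \<Rightarrow> complex^'n \<Rightarrow> complex" where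
  "quad_form A x = (\<Sum>i\<in>UNIV. cnj (x $ i) * (A *v x) $ i)"

lemma pos_semidef_iff_quad_form: "pos_semidef A \<longleftrightarrow> (\<forall>x. quad_form A x \<in> \<real>\<^sub>\<ge>\<^sub>0)"
  by (simp add: pos_semidef_def quad_form_def)

lemma quad_form_entries:
  "quad_form A x = (\<Sum>i\<in>UNIV. \<Sum>j\<in>UNIV. cnj (x $ i) * A $ i $ j * x $ j)"
  by (simp add: quad_form_def matrix_vector_mult_def sum_distrib_left mult.assoc)

lemma quad_form_axis: "quad_form A (axis k 1) = A $ k $ k"
  by (simp add: quad_form_def axis_def matrix_vector_mult_def if_distrib[of cnj] if_distrib[of "\<lambda>a. a * _"]
      if_distrib[of "\<lambda>a. _ * a"] cong: if_cong)

text \<open>As a function of \<open>c\<close> this is a quadratic polynomial with leading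
  coefficient \<open>A $ k $ k\<close>. A vanishing leading coefficient leaves a real-affine
  function, and a nonzero one permits completing the square; the next results use these two
  cases.\<close>

lemma quad_form_add_axis:
  assumes "hermitian_mat A"
  shows "quad_form A (x + c *s axis k 1) =
    quad_form A x + c * cnj ((A *v x) $ k) + cnj c * (A *v x) $ k + c * cnj c * A $ k $ k"
proof -
  have col: "(A *v (c *s axis k 1)) $ i = c * A $ i $ k" for i
    by (simp add: matrix_vector_mult_def axis_def if_distrib[of "\<lambda>a. _ * a"] mult.commute cong: if_cong)
  have "cnj (A $ k $ i) = A $ i $ k" for i
    using assms by (simp add: hermitian_mat_iff)
  then have cross: "(\<Sum>i\<in>UNIV. cnj (x $ i) * (c * A $ i $ k)) = c * cnj ((A *v x) $ k)"
    by (simp add: matrix_vector_mult_def sum_distrib_left mult_ac)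
  have axis: "(\<Sum>i\<in>UNIV. cnj ((c *s axis k 1) $ i) * f i) = cnj c * f k" for f :: "'a \<Rightarrow> complex"
    by (simp add: axis_def if_distrib[of cnj] if_distrib[of "\<lambda>a. a * _"]
        if_distrib[of "\<lambda>a. _ * a"] cong: if_cong)
  have "quad_form A (x + c *s axis k 1) =
      (\<Sum>i\<in>UNIV. cnj (x $ i) * (A *v x) $ i) + (\<Sum>i\<in>UNIV. cnj (x $ i) * (c * A $ i $ k))
      + (\<Sum>i\<in>UNIV. cnj ((c *s axis k 1) $ i) * ((A *v x) $ i + c * A $ i $ k))"
    unfolding quad_form_def matrix_vector_right_distrib vector_add_component col sum.distrib[symmetric]
    by (intro sum.cong refl) (simp add: algebra_simps)
  then show ?thesis
    unfolding axis cross by (simp add: quad_form_def algebra_simps)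
qed

lemma pos_semidef_diag:
  assumes "pos_semidef A"
  shows "A $ k $ k \<in> \<real>\<^sub>\<ge>\<^sub>0"
  using assms by (metis pos_semidef_iff_quad_form quad_form_axis)

text \<open>Along \<open>axis k 1\<close> the form is then affine, so a nonzero entry
  \<open>A $ k $ i\<close> would let it become negative near \<open>axis i 1\<close>.\<close>

lemma pos_semidef_zero_diag:
  assumes herm: "hermitian_mat A" and psd: "pos_semidef A" and zero: "A $ k $ k = 0"
  shows "A $ k $ i = 0"
proof (rule ccontr)
  assume nz: "A $ k $ i \<noteq> 0"
  define a where "a = A $ k $ i"
  \<comment> \<open>Chosen so that the cross terms contribute
    \<open>- 2 * (1 + Re (A $ i $ i))\<close>, which outweighs the nonnegative
    \<open>A $ i $ i\<close>.\<close>
  define s where "s = (1 + Re (A $ i $ i)) / (cmod a)\<^sup>2"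
  have *: "a * cnj a = of_real ((cmod a)\<^sup>2)"
    by (metis complex_norm_square)
  have "(A *v axis i 1) $ k = a"
    by (simp add: a_def matrix_vector_mult_def axis_def if_distrib[of "\<lambda>a. _ * a"] cong: if_cong)
  then have "quad_form A (axis i 1 + (- of_real s * a) *s axis k 1) =
      A $ i $ i - 2 * of_real s * (a * cnj a)"
    unfolding quad_form_add_axis[OF herm] by (simp add: quad_form_axis zero algebra_simps)
  also have "Re \<dots> = Re (A $ i $ i) - 2 * (s * (cmod a)\<^sup>2)"
    unfolding * by simp
  also have "s * (cmod a)\<^sup>2 = 1 + Re (A $ i $ i)"
    using nz by (simp add: s_def a_def)
  finally have "Re (quad_form A (axis i 1 + (- of_real s * a) *s axis k 1)) < 0"
    using pos_semidef_diag[OF psd, of i] by (simp add: complex_nonneg_Reals_iff)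
  then show False
    using psd by (metis pos_semidef_iff_quad_form complex_nonneg_Reals_iff not_less)
qed

text \<open>The matrix keeps its full size, so that an induction can stay within one type; for a
  nonzero pivot \<open>A $ k $ k\<close>, row and column \<open>k\<close> become zero.\<close>

definition schur_complement :: "'n \<Rightarrow> complex^'n^'n \<Rightarrow> complex^'n^'n" where
  "schur_complement k A = (\<chi> i j. A $ i $ j - A $ i $ k * A $ k $ j / A $ k $ k)"

lemma hermitian_schur_complement:
  assumes "hermitian_mat A"
  shows "hermitian_mat (schur_complement k A)"
  using assms by (simp add: hermitian_mat_iff schur_complement_def mult.commute)

text \<open>The form of the Schur complement at x is the minimum of the form of A over all x + c *s axis k 1.\<close>

lemma pos_semidef_schur_complement:
  assumes herm: "hermitian_mat A" and psd: "pos_semidef A" and nz: "A $ k $ k \<noteq> 0"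
  shows "pos_semidef (schur_complement k A)"
  unfolding pos_semidef_iff_quad_form
proof
  fix x
  define w where "w = (A *v x) $ k"
  have real: "cnj (A $ k $ k) = A $ k $ k" and flip: "\<And>i. cnj (A $ k $ i) = A $ i $ k"
    using herm by (simp_all add: hermitian_mat_iff)
  have "(schur_complement k A *v x) $ i = (A *v x) $ i - A $ i $ k * w / A $ k $ k" for i
    by (simp add: schur_complement_def matrix_vector_mult_def w_def sum_distrib_left
        sum_divide_distrib algebra_simps flip: sum_subtractf)
  then have "quad_form (schur_complement k A) x =
      quad_form A x - (\<Sum>i\<in>UNIV. cnj (x $ i) * A $ i $ k) * w / A $ k $ k"
    by (simp add: quad_form_def right_diff_distrib sum_subtractf sum_distrib_left
        sum_divide_distrib mult_ac)
  also have "(\<Sum>i\<in>UNIV. cnj (x $ i) * A $ i $ k) = cnj w"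
    by (simp add: w_def matrix_vector_mult_def flip mult.commute)
  \<comment> \<open>Completing the square: at \<open>c = - w / A $ k $ k\<close> each of the two
    cross terms gives \<open>- cnj w * w / A $ k $ k\<close>, and the quadratic term restores one of
    them.\<close>
  also have "quad_form A x - cnj w * w / A $ k $ k =
      quad_form A (x + (- w / A $ k $ k) *s axis k 1)"
    unfolding quad_form_add_axis[OF herm] w_def[symmetric] using nz by (simp add: real field_simps)
  finally show "quad_form (schur_complement k A) x \<in> \<real>\<^sub>\<ge>\<^sub>0"
    using psd by (metis pos_semidef_iff_quad_form)
qed

text \<open>With \<open>v = column k A\<close>, the part split off is the rank-one matrix of entries
  \<open>v $ i * cnj (v $ j) / A $ k $ k\<close>. For a zero pivot both corrections vanish, since
  division by zero yields zero.\<close>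

lemma trace_schur_complement_mult:
  assumes "hermitian_mat A"
  shows "trace (A ** B) =
    trace (schur_complement k A ** B) + quad_form B (column k A) / A $ k $ k"
proof -
  have flip: "cnj (A $ i $ k) = A $ k $ i" for i
    using assms by (simp add: hermitian_mat_iff)
  have "quad_form B (column k A) / A $ k $ k =
      (\<Sum>i\<in>UNIV. \<Sum>j\<in>UNIV. A $ k $ j * B $ j $ i * A $ i $ k / A $ k $ k)"
    unfolding quad_form_entries by (subst sum.swap) (simp add: column_def flip sum_divide_distrib)
  then show ?thesis
    by (simp add: trace_def matrix_matrix_mult_def schur_complement_def algebra_simps
        flip: sum.distrib)
qed

lemma trace_mult_pos_semidef:
  assumes "hermitian_mat A" "pos_semidef A" "pos_semidef B"
  shows "trace (A ** B) \<in> \<real>\<^sub>\<ge>\<^sub>0"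
  using assms
proof (induction "card {i. A $ i $ i \<noteq> 0}" arbitrary: A rule: less_induct)
  case less
  note herm = less.prems(1) and psd = less.prems(2)
  show ?case
  proof (cases "\<exists>k. A $ k $ k \<noteq> 0")
    case False
    then have "A $ i $ j = 0" for i j
      using pos_semidef_zero_diag[OF herm psd] by blast
    then show ?thesis
      by (simp add: trace_def matrix_matrix_mult_def)
  next
    case True
    then obtain k where k: "A $ k $ k \<noteq> 0" by blast
    let ?A = "schur_complement k A"
    have "{i. ?A $ i $ i \<noteq> 0} \<subset> {i. A $ i $ i \<noteq> 0}"
    proof
      show "{i. ?A $ i $ i \<noteq> 0} \<subseteq> {i. A $ i $ i \<noteq> 0}"
        \<comment> \<open>A zero diagonal entry of \<open>A\<close> stays zero: its whole row
          vanishes, and with it the subtracted product.\<close>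
        using pos_semidef_zero_diag[OF herm psd] by (auto simp: schur_complement_def)
      have "?A $ k $ k = 0"
        using k by (simp add: schur_complement_def)
      with k show "{i. ?A $ i $ i \<noteq> 0} \<noteq> {i. A $ i $ i \<noteq> 0}" by blast
    qed
    then have "card {i. ?A $ i $ i \<noteq> 0} < card {i. A $ i $ i \<noteq> 0}"
      by (simp add: psubset_card_mono)
    then have "trace (?A ** B) \<in> \<real>\<^sub>\<ge>\<^sub>0"
      using less.hyps hermitian_schur_complement[OF herm]
        pos_semidef_schur_complement[OF herm psd k] less.prems(3) by blast
    moreover have "quad_form B (column k A) / A $ k $ k \<in> \<real>\<^sub>\<ge>\<^sub>0"
      using less.prems(3) pos_semidef_diag[OF psd]
      by (simp add: pos_semidef_iff_quad_form nonneg_Reals_divide_I)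
    ultimately show ?thesis
      unfolding trace_schur_complement_mult[OF herm, of B k] by (rule nonneg_Reals_add_I)
  qed
qed

text \<open>Transposing the matrix amounts to conjugating the argument of the form.\<close>

lemma pos_semidef_transpose:
  assumes "pos_semidef A"
  shows "pos_semidef (transpose A)"
  unfolding pos_semidef_iff_quad_form
proof
  fix x
  have "quad_form (transpose A) x = quad_form A (\<chi> i. cnj (x $ i))"
    unfolding quad_form_entries by (subst sum.swap) (simp add: transpose_def mult_ac)
  then show "quad_form (transpose A) x \<in> \<real>\<^sub>\<ge>\<^sub>0"
    using assms by (simp add: pos_semidef_iff_quad_form)
qed

text \<open>\<open>R_mat\<close> is symmetric and \<open>I_mat\<close> skew-symmetric, so the
  difference sums the plain squares (not moduli) of the entries of both; the identity (a + b)^2 + (a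
  - b)^2 = 2 a^2 + 2 b^2 reduces this to the squares of the entries of \<rho>.\<close>

lemma trace_R_square_minus_I_square:
  fixes \<rho> :: "complex^'d^'d"
  shows "trace (R_mat \<rho> ** R_mat \<rho>) - trace (I_mat \<rho> ** I_mat \<rho>) =
    of_nat (CARD('d)\<^sup>2) * trace (\<rho> ** transpose \<rho>)"
proof -
  let ?d = "of_nat CARD('d) :: complex"
  have "R_mat \<rho> $ i $ j * R_mat \<rho> $ j $ i - I_mat \<rho> $ i $ j * I_mat \<rho> $ j $ i =
      ?d\<^sup>2 / 2 * (\<rho> $ i $ j * \<rho> $ i $ j) + ?d\<^sup>2 / 2 * (\<rho> $ j $ i * \<rho> $ j $ i)" for i j
    by (simp add: R_mat_def I_mat_def transpose_def scaleR_conv_of_real[where 'a = complex]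
        field_simps power2_eq_square)
  then have "trace (R_mat \<rho> ** R_mat \<rho>) - trace (I_mat \<rho> ** I_mat \<rho>) =
      ?d\<^sup>2 / 2 * (\<Sum>i\<in>UNIV. \<Sum>j\<in>UNIV. \<rho> $ i $ j * \<rho> $ i $ j)
      + ?d\<^sup>2 / 2 * (\<Sum>i\<in>UNIV. \<Sum>j\<in>UNIV. \<rho> $ j $ i * \<rho> $ j $ i)"
    by (simp only: trace_def matrix_matrix_mult_def vec_lambda_beta sum.distrib sum_distrib_left
        flip: sum_subtractf)
  also have "(\<Sum>i\<in>UNIV. \<Sum>j\<in>UNIV. \<rho> $ j $ i * \<rho> $ j $ i) =
      (\<Sum>i\<in>UNIV. \<Sum>j\<in>UNIV. \<rho> $ i $ j * \<rho> $ i $ j)"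
    by (rule sum.swap)
  finally show ?thesis
    by (simp add: trace_def matrix_matrix_mult_def transpose_def)
qed

theorem proposition1:
  fixes \<rho> :: "complex^'d^'d"
  assumes "quantum_state \<rho>"
  shows "(S_I \<rho>)\<^sup>2 \<le> 1 + (S_R \<rho>)\<^sup>2"
proof -
  have herm: "hermitian_mat \<rho>" and psd: "pos_semidef \<rho>"
    using assms by (auto simp: quantum_state_def)
  \<comment> \<open>Nonnegativity lets squaring undo the square root in
    \<open>normalized_size\<close>.\<close>
  have "0 \<le> Re (trace (I_mat \<rho> ** I_mat \<rho>))"
    by (simp add: trace_square_hermitian[OF hermitian_parts(2)[OF herm]] sum_nonneg)
  then have I: "(S_I \<rho>)\<^sup>2 = Re (trace (I_mat \<rho> ** I_mat \<rho>)) / real CARD('d)"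
    by (simp add: S_I_def normalized_size_def)
  have "trace (R_mat \<rho> ** R_mat \<rho>) - trace (I_mat \<rho> ** I_mat \<rho>) \<in> \<real>\<^sub>\<ge>\<^sub>0"
    unfolding trace_R_square_minus_I_square
    by (intro nonneg_Reals_mult_I trace_mult_pos_semidef herm psd pos_semidef_transpose) simp
  then have "Re (trace (I_mat \<rho> ** I_mat \<rho>)) \<le> Re (trace (R_mat \<rho> ** R_mat \<rho>))"
    by (simp add: complex_nonneg_Reals_iff)
  then show ?thesis
    unfolding I S_R_square[OF assms] by (simp add: divide_right_mono)
qed

end
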